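(* Let $\frac13<\sigma<\frac12$ and define $f_\sigma:\mathbb R\to\mathbb R$ by $f_\sigma(x)=e^{-x^2}\sum_{m=1}^\infty 5^{-m}m^{-\sigma}\cos(5^m x)$. Then $f_\sigma$ does not have the $(1,1)$-$N$-property, i.e. there exists a set $E\subset\mathbb R$ with $\mathcal H^1(E)=0$ and $\mathcal H^1(f_\sigma(E))>0$.
   Context: $\mathcal H^1$ denotes one-dimensional Hausdorff (equivalently Lebesgue) measure on $\mathbb R$. *)

theory Defs
  imports "HOL-Analysis.Analysis"
begin

definition f_sigma :: "real \<Rightarrow> real \<Rightarrow> real" where
  "f_sigma \<sigma> x = exp (- (x^2)) *
     (\<Sum>m. (5::real) powr (- real (Suc m)) * real (Suc m) powr (- \<sigma>) * cos (5 ^ (Suc m) * x))"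

end

theory Submission
  imports Defs "HOL-Real_Asymp.Real_Asymp"
begin

text \<open>
  After the substitution \<open>x \<mapsto> 2 * pi * (x - 1)\<close> the difference quotients of the function over the
  5-adic cells of \<open>[0, 1]\<close> form a martingale. Its increments tend to zero because the coefficients
  \<open>m powr - \<sigma>\<close> do, but their conditional variances are at least of order \<open>m powr (-2 * \<sigma>)\<close>, whose sum
  diverges for \<open>\<sigma> \<le> 1 / 2\<close>. Start in a small cell with slope at least \<open>\<kappa> > 0\<close> and stop once the
  slope falls below a small fraction of \<open>\<kappa>\<close>. Almost every point is stopped. On the other hand the image of a
  stopping cell is short compared with the cell, so the images of all stopping cells together cannot
  cover the image of the starting cell, and the null set of points that are never stopped has an
  image that is not null.
\<close>

section \<open>Stopping a 5-adic martingale\<close>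

text \<open>A number \<open>k\<close> names a 5-adic cell, with parent \<open>k div 5\<close> and
  children \<open>5 * k + j\<close> for \<open>j < 5\<close>. Levels are counted from the starting
  cell \<open>r\<close>, whose own value is not tested.\<close>

primrec alive :: "(nat \<Rightarrow> nat \<Rightarrow> real) \<Rightarrow> real \<Rightarrow> nat \<Rightarrow> nat \<Rightarrow> nat set" where
  "alive s \<delta> r 0 = {r}"
| "alive s \<delta> r (Suc i) = {k. k div 5 \<in> alive s \<delta> r i \<and> \<delta> < s (Suc i) k}"

lemma finite_children: "finite A \<Longrightarrow> finite {k::nat. k div 5 \<in> A}"
proof -
  assume "finite A"
  have "{k::nat. k div 5 \<in> A} \<subseteq> (\<lambda>(k, j). 5 * k + j) ` (A \<times> {..<5})"
  proof
    fix k :: nat assume "k \<in> {k. k div 5 \<in> A}"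
    then have "(k div 5, k mod 5) \<in> A \<times> {..<5}" by simp
    moreover have "k = (\<lambda>(k, j). 5 * k + j) (k div 5, k mod 5)" by simp
    ultimately show "k \<in> (\<lambda>(k, j). 5 * k + j) ` (A \<times> {..<5})" by blast
  qed
  with \<open>finite A\<close> show ?thesis by (meson finite_SigmaI finite_imageI finite_lessThan finite_subset)
qed

lemma finite_alive: "finite (alive s \<delta> r i)"
proof (induction i)
  case (Suc i)
  show ?case
    by (rule finite_subset[OF _ finite_children[OF Suc.IH]]) auto
qed simp

lemma sum_children:
  fixes \<phi> :: "nat \<Rightarrow> real"
  assumes "finite A"
  shows "(\<Sum>k | k div 5 \<in> A. \<phi> k) = (\<Sum>k\<in>A. \<Sum>j<5. \<phi> (5 * k + j))"
proof -
  have "(\<Sum>k\<in>A. \<Sum>j<5. \<phi> (5 * k + j)) = (\<Sum>(k, j)\<in>A \<times> {..<5}. \<phi> (5 * k + j))"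
    using assms by (simp add: sum.Sigma)
  also have "\<dots> = (\<Sum>k | k div 5 \<in> A. \<phi> k)"
    by (rule sum.reindex_bij_witness[of _ "\<lambda>k. (k div 5, k mod 5)" "\<lambda>(k, j). 5 * k + j"]) auto
  finally show ?thesis by simp
qed

text \<open>Squaring \<open>1 + u / 2 \<le> exp (u / 2)\<close> suffices, and
  \<open>-2 \<le> u\<close> keeps the left side nonnegative. The surplus over \<open>1 + u\<close>
  is what turns variance into growth of \<open>exp (- s)\<close>.\<close>

lemma exp_ge_quadratic:
  fixes u :: real
  assumes "-2 \<le> u"
  shows "1 + u + u\<^sup>2 / 4 \<le> exp u"
proof -
  have "(1 + u / 2)\<^sup>2 \<le> (exp (u / 2))\<^sup>2"
    using assms by (intro power_mono) auto
  also have "(exp (u / 2))\<^sup>2 = exp u"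
    by (simp flip: exp_double)
  finally show ?thesis by (simp add: power2_eq_square algebra_simps)
qed

text \<open>
  The bounded submartingale \<open>exp (- s)\<close>, stopped at the threshold \<open>\<delta>\<close>, gains in every step a fixed
  fraction of the conditional variance times its value. This is impossible for a divergent sum of
  variances unless almost every path stops.
\<close>

lemma alive_density_small:
  fixes s :: "nat \<Rightarrow> nat \<Rightarrow> real"
  assumes avg: "\<And>i k. (\<Sum>j<5. s (Suc i) (5 * k + j)) = 5 * s i k"
    and inc: "\<And>i k. k div 5 \<in> alive s \<delta> r i \<Longrightarrow> \<bar>s (Suc i) k - s i (k div 5)\<bar> \<le> \<eta>"
    and \<eta>: "\<eta> \<le> \<delta>" "\<eta> \<le> 2" "0 \<le> \<eta>" and root: "\<delta> < s 0 r"
    and var: "\<And>i k. k \<in> alive s \<delta> r i \<Longrightarrow>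
          (c i)\<^sup>2 \<le> (\<Sum>j<5. (s (Suc i) (5 * k + j) - s i k)\<^sup>2)"
    and div: "\<not> summable (\<lambda>i. (c i)\<^sup>2)"
    and "0 < \<epsilon>"
  shows "\<exists>i. card (alive s \<delta> r i) / 5 ^ i < \<epsilon>"
proof (rule ccontr)
  assume "\<not> ?thesis"
  define A where "A i = alive s \<delta> r i" for i
  \<comment> \<open>All three are normalized by the starting cell: \<open>lam\<close> is the
    surviving proportion, and \<open>U\<close> and \<open>V\<close> are the integrals of
    \<open>s\<close> and \<open>exp (- s)\<close> over the surviving part.\<close>
  define lam where "lam i = card (A i) / 5 ^ i" for i
  define U where "U i = (\<Sum>k\<in>A i. s i k) / 5 ^ i" for i
  define V where "V i = (\<Sum>k\<in>A i. exp (- s i k)) / 5 ^ i" for i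
  from \<open>\<not> ?thesis\<close> have lam_ge: "\<epsilon> \<le> lam i" for i
    by (auto simp: lam_def A_def not_less)
  have fin: "finite (A i)" for i by (simp add: A_def finite_alive)
  have s_gt: "\<delta> < s i k" if "k \<in> A i" for i k
    using that root by (cases i) (auto simp: A_def)
  define C where "C i = {k. k div 5 \<in> A i}" for i
  have finC: "finite (C i)" for i using fin finite_children by (simp add: C_def)
  have sub: "A (Suc i) \<subseteq> C i" for i by (auto simp: A_def C_def)
  have sumC: "(\<Sum>k\<in>C i. \<phi> k) = (\<Sum>k\<in>A i. \<Sum>j<5. \<phi> (5 * k + j))" for i and \<phi> :: "nat \<Rightarrow> real"
    using sum_children[OF fin] by (simp add: C_def)
  have split: "(\<Sum>k\<in>C i. \<phi> k) = (\<Sum>k\<in>A (Suc i). \<phi> k) + (\<Sum>k\<in>C i - A (Suc i). \<phi> k)"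
    for i and \<phi> :: "nat \<Rightarrow> real"
    using sum.subset_diff[OF sub finC] by (simp add: add.commute)
  \<comment> \<open>Every child of a survivor starts from a value above \<delta> and drops by at
    most \<eta> \<le> \<delta>, so stopping never overshoots below zero.\<close>
  have s_nonneg: "0 \<le> s (Suc i) k" if "k \<in> C i" for i k
    using inc[of k i] s_gt[of "k div 5" i] that \<eta> by (auto simp: A_def C_def)
  have U_step: "U (Suc i) \<le> U i" for i
  proof -
    have "(\<Sum>k\<in>A (Suc i). s (Suc i) k) \<le> (\<Sum>k\<in>C i. s (Suc i) k)"
      unfolding split using s_nonneg by (auto intro!: sum_nonneg)
    also have "\<dots> = 5 * (\<Sum>k\<in>A i. s i k)"
      by (simp only: sumC avg flip: sum_distrib_left)
    finally show ?thesis by (simp add: U_def field_simps)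
  qed
  have U_le: "U i \<le> s 0 r" for i
  proof (induction i)
    case (Suc i) then show ?case using U_step[of i] by simp
  qed (simp add: U_def A_def)
  \<comment> \<open>The five children of a survivor gain \<open>(c i)\<^sup>2 / 4\<close> times its
    \<open>exp (- s i k)\<close>, which normalization turns into \<open>(c i)\<^sup>2 / 20\<close>.
    A stopped child carries \<open>exp (- s) \<le> 1\<close>, so stopping costs at most the lost
    proportion \<open>lam i - lam (Suc i)\<close>.\<close>
  have V_step: "V i + (c i)\<^sup>2 / 20 * V i \<le> V (Suc i) + (lam i - lam (Suc i))" for i
  proof -
    have "(5 + (c i)\<^sup>2 / 4) * exp (- s i k) \<le> (\<Sum>j<5. exp (- s (Suc i) (5 * k + j)))"
      if k: "k \<in> A i" for k
    proof -
      define t where "t j = s (Suc i) (5 * k + j) - s i k" for j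
      have t: "t j \<le> 2" if "j < 5" for j
        using inc[of "5 * k + j" i] k that \<eta> by (auto simp: t_def A_def)
      have t0: "(\<Sum>j<5. t j) = 0"
        using avg[of i k] by (simp add: t_def sum_subtractf)
      have "(c i)\<^sup>2 \<le> (\<Sum>j<5. (t j)\<^sup>2)"
        using var k by (simp add: t_def A_def)
      then have "5 + (c i)\<^sup>2 / 4 \<le> (\<Sum>j<5. 1 + - t j + (- t j)\<^sup>2 / 4)"
        using t0 by (simp add: sum.distrib sum_subtractf flip: sum_divide_distrib)
      also have "\<dots> \<le> (\<Sum>j<5. exp (- t j))"
        using t by (intro sum_mono exp_ge_quadratic) force
      finally have "(5 + (c i)\<^sup>2 / 4) * exp (- s i k) \<le> (\<Sum>j<5. exp (- t j)) * exp (- s i k)"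
        by (intro mult_right_mono) auto
      also have "\<dots> = (\<Sum>j<5. exp (- s (Suc i) (5 * k + j)))"
        by (simp add: sum_distrib_right t_def flip: exp_add)
      finally show ?thesis .
    qed
    then have "(\<Sum>k\<in>A i. (5 + (c i)\<^sup>2 / 4) * exp (- s i k)) \<le> (\<Sum>k\<in>C i. exp (- s (Suc i) k))"
      unfolding sumC by (intro sum_mono) auto
    also have "\<dots> \<le> (\<Sum>k\<in>A (Suc i). exp (- s (Suc i) k)) + (\<Sum>k\<in>C i - A (Suc i). 1)"
      unfolding split using s_nonneg by (intro add_left_mono sum_mono) auto
    also have "(\<Sum>k\<in>C i - A (Suc i). 1) = 5 * real (card (A i)) - real (card (A (Suc i)))"
      using split[where \<phi> = "\<lambda>_. 1" and i = i] sumC[where \<phi> = "\<lambda>_. 1" and i = i] by simp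
    finally have "(5 + (c i)\<^sup>2 / 4) * (\<Sum>k\<in>A i. exp (- s i k)) \<le>
        (\<Sum>k\<in>A (Suc i). exp (- s (Suc i) k)) + (5 * real (card (A i)) - real (card (A (Suc i))))"
      by (simp only: sum_distrib_left)
    then have "(5 + (c i)\<^sup>2 / 4) * (\<Sum>k\<in>A i. exp (- s i k)) / 5 ^ Suc i \<le>
        ((\<Sum>k\<in>A (Suc i). exp (- s (Suc i) k)) + (5 * real (card (A i)) - real (card (A (Suc i)))))
          / 5 ^ Suc i"
      by (rule divide_right_mono) simp
    then show ?thesis by (simp add: V_def lam_def add_divide_distrib diff_divide_distrib ring_distribs)
  qed
  have lam0: "lam 0 = 1" by (simp add: lam_def A_def)
  have V_nonneg: "0 \<le> V i" for i unfolding V_def by (intro divide_nonneg_pos sum_nonneg) auto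
  have V_le: "V i \<le> lam i" for i
  proof -
    have "(\<Sum>k\<in>A i. exp (- s i k)) \<le> (\<Sum>k\<in>A i. 1)"
      using s_gt \<eta> by (intro sum_mono) (force simp: less_eq_real_def)
    then show ?thesis by (simp add: V_def lam_def divide_right_mono)
  qed
  \<comment> \<open>Summing \<open>V_step\<close> telescopes \<open>V - lam\<close>, which starts at
    or above -1 and never exceeds 0.\<close>
  have sum_le: "(\<Sum>i<n. (c i)\<^sup>2 / 20 * V i) \<le> 1" for n
  proof -
    have "(\<Sum>i<n. (c i)\<^sup>2 / 20 * V i) \<le> (V n - lam n) - (V 0 - lam 0)"
    proof (induction n)
      case (Suc n) then show ?case using V_step[of n] by simp
    qed simp
    then show ?thesis using V_le[of n] V_nonneg[of 0] lam0 by simp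
  qed
  \<comment> \<open>The survivors keep proportion at least \<epsilon> while
    \<open>U i \<le> s 0 r\<close>, so \<open>s\<close> averages at most \<open>L\<close> over them.
    As in Jensen's inequality, the tangent line of \<open>exp (- s)\<close> at \<open>L\<close> then
    keeps \<open>V\<close> away from zero.\<close>
  define L where "L = s 0 r / \<epsilon>"
  have V_ge: "exp (- L) * \<epsilon> \<le> V i" for i
  proof -
    have "exp (- L) * (1 + L - s i k) \<le> exp (- s i k)" for k
    proof -
      have "exp (- L) * (1 + (L - s i k)) \<le> exp (- L) * exp (L - s i k)"
        by (intro mult_left_mono) auto
      then show ?thesis by (simp add: add_diff_eq flip: exp_add)
    qed
    then have "(\<Sum>k\<in>A i. exp (- L) * (1 + L - s i k)) / 5 ^ i \<le> V i"
      unfolding V_def by (intro divide_right_mono sum_mono) auto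
    also have "(\<Sum>k\<in>A i. exp (- L) * (1 + L - s i k)) / 5 ^ i = exp (- L) * ((1 + L) * lam i - U i)"
      by (simp add: lam_def U_def sum_subtractf mult.commute flip: sum_distrib_left) (simp add: field_simps)
    finally have "exp (- L) * ((1 + L) * lam i - U i) \<le> V i" .
    moreover have "\<epsilon> \<le> (1 + L) * lam i - U i"
    proof -
      have "0 \<le> L" using root \<eta> \<open>0 < \<epsilon>\<close> by (simp add: L_def)
      then have "(1 + L) * \<epsilon> \<le> (1 + L) * lam i" using lam_ge by (intro mult_left_mono) auto
      moreover have "(1 + L) * \<epsilon> = \<epsilon> + s 0 r" using \<open>0 < \<epsilon>\<close> by (simp add: L_def field_simps)
      ultimately show ?thesis using U_le[of i] by linarith
    qed
    ultimately show ?thesis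
      by (meson exp_ge_zero mult_left_mono order_trans)
  qed
  have "summable (\<lambda>i. (c i)\<^sup>2)"
  proof (rule summableI_nonneg_bounded)
    fix n
    have "(\<Sum>i<n. (c i)\<^sup>2) * (exp (- L) * \<epsilon> / 20) \<le> (\<Sum>i<n. (c i)\<^sup>2 / 20 * V i)"
      unfolding sum_distrib_right
    proof (intro sum_mono)
      fix i
      show "(c i)\<^sup>2 * (exp (- L) * \<epsilon> / 20) \<le> (c i)\<^sup>2 / 20 * V i"
        using mult_left_mono[OF V_ge[of i], of "(c i)\<^sup>2 / 20"] by simp
    qed
    then have "(\<Sum>i<n. (c i)\<^sup>2) * (exp (- L) * \<epsilon> / 20) \<le> 1"
      using sum_le[of n] by linarith
    then show "(\<Sum>i<n. (c i)\<^sup>2) \<le> 1 / (exp (- L) * \<epsilon> / 20)"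
      using \<open>0 < \<epsilon>\<close> by (subst pos_le_divide_eq) auto
  qed simp
  with div show False by contradiction
qed

section \<open>Slopes over 5-adic cells\<close>

definition cell :: "nat \<Rightarrow> nat \<Rightarrow> real set" where
  "cell n k = {real k / 5 ^ n .. (real k + 1) / 5 ^ n}"

definition slope :: "(real \<Rightarrow> real) \<Rightarrow> nat \<Rightarrow> nat \<Rightarrow> real" where
  "slope F n k = 5 ^ n * (F ((real k + 1) / 5 ^ n) - F (real k / 5 ^ n))"

lemma endpoints_in_cell: "real k / 5 ^ n \<in> cell n k" "(real k + 1) / 5 ^ n \<in> cell n k"
  by (auto simp: cell_def divide_right_mono)

lemma cell_diameter: "x \<in> cell n k \<Longrightarrow> y \<in> cell n k \<Longrightarrow> \<bar>x - y\<bar> \<le> 1 / 5 ^ n"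
  by (auto simp: cell_def abs_le_iff add_divide_distrib)

lemma abs_slope_diff_le:
  assumes "\<bar>F ((real k + 1) / 5 ^ n) - F (real k / 5 ^ n) - a * ((real k + 1) / 5 ^ n - real k / 5 ^ n)\<bar> \<le> e"
  shows "\<bar>slope F n k - a\<bar> \<le> 5 ^ n * e"
proof -
  have "slope F n k - a =
      5 ^ n * (F ((real k + 1) / 5 ^ n) - F (real k / 5 ^ n) - a * ((real k + 1) / 5 ^ n - real k / 5 ^ n))"
    by (simp add: slope_def right_diff_distrib add_divide_distrib)
  then show ?thesis using assms by (simp only: abs_mult) simp
qed

lemma cell_child_subset: "cell (Suc n) k \<subseteq> cell n (k div 5)"
proof -
  have "5 * (k div 5) \<le> k" "k + 1 \<le> 5 * (k div 5 + 1)" by auto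
  then have "real (5 * (k div 5)) \<le> real k" "real (k + 1) \<le> real (5 * (k div 5 + 1))"
    by (simp_all only: of_nat_le_iff)
  then have "5 * real (k div 5) \<le> real k" "real k + 1 \<le> 5 * (real (k div 5) + 1)"
    by (simp_all only: of_nat_add of_nat_mult of_nat_numeral of_nat_1)
  then have "5 * real (k div 5) / 5 ^ Suc n \<le> real k / 5 ^ Suc n"
    "(real k + 1) / 5 ^ Suc n \<le> 5 * (real (k div 5) + 1) / 5 ^ Suc n"
    by (intro divide_right_mono; simp)+
  moreover have "5 * b / 5 ^ Suc n = b / 5 ^ n" for b :: real by simp
  ultimately show ?thesis unfolding cell_def by (simp only: atLeastatMost_subset_iff) blast
qed

lemma cell_children_cover:
  assumes "x \<in> cell n k"
  obtains k' where "k' div 5 = k" "x \<in> cell (Suc n) k'"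
proof -
  define t where "t = 5 ^ Suc n * x"
  have t: "5 * real k \<le> t" "t \<le> 5 * real k + 5"
    using assms by (auto simp: cell_def t_def field_simps)
  have *: "x \<in> cell (Suc n) m \<longleftrightarrow> real m \<le> t \<and> t \<le> real m + 1" for m
    by (auto simp: cell_def t_def field_simps)
  show thesis
  proof (cases "t = 5 * real k + 5")
    \<comment> \<open>At the right endpoint the floor of \<open>t\<close> would be
      \<open>5 * k + 5\<close>, a child of the next cell, so the last child is chosen by
      hand.\<close>
    case True
    then show thesis by (intro that[of "5 * k + 4"]) (auto simp: *)
  next
    case False
    define m where "m = nat \<lfloor>t\<rfloor>"
    have "real m \<le> t" "t < real m + 1" using t by (auto simp: m_def)
    moreover from this t False have "5 * k \<le> m" "m < 5 * k + 5" by linarith+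
    ultimately show thesis by (intro that[of m]) (auto simp: *)
  qed
qed

lemma cell_subset_unit: "k < 5 ^ n \<Longrightarrow> cell n k \<subseteq> {0..1}"
proof -
  assume "k < 5 ^ n"
  then have "real (k + 1) \<le> real (5 ^ n)" by (subst of_nat_le_iff) simp
  then show ?thesis by (auto simp: cell_def field_simps intro: order_trans)
qed

text \<open>This is the martingale property: the increments of \<open>F\<close> over the five
  children telescope to the increment over the parent.\<close>

lemma sum_slope_children: "(\<Sum>j<5. slope F (Suc n) (5 * k + j)) = 5 * slope F n k"
proof -
  define f where "f j = F ((5 * real k + real j) / 5 ^ Suc n)" for j
  have "(\<Sum>j<5. slope F (Suc n) (5 * k + j)) = 5 ^ Suc n * (\<Sum>j<5. f (Suc j) - f j)"
    by (simp add: slope_def f_def sum_distrib_left algebra_simps)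
  also have "\<dots> = 5 ^ Suc n * (f 5 - f 0)" by (simp only: sum_lessThan_telescope)
  also have "f 5 = F ((real k + 1) / 5 ^ n)"
  proof -
    have "(5 * real k + real 5) / 5 ^ Suc n = (real k + 1) / 5 ^ n" by (simp add: field_simps)
    then show ?thesis by (simp only: f_def)
  qed
  also have "f 0 = F (real k / 5 ^ n)" by (simp add: f_def)
  finally show ?thesis by (simp add: slope_def)
qed

text \<open>The slopes of one level average to \<open>F 1 - F 0\<close> by telescoping, so they
  cannot all lie below it. This supplies a steep starting cell at any level, however fine.\<close>

lemma exists_slope_ge: "\<exists>k<5 ^ n. F 1 - F 0 \<le> slope F n k"
proof (rule ccontr)
  assume "\<not> ?thesis"
  then have "(\<Sum>k<5 ^ n. slope F n k) < (\<Sum>k<(5::nat) ^ n. F 1 - F 0)"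
    by (intro sum_strict_mono) (auto simp: lessThan_empty_iff)
  moreover have "(\<Sum>k<5 ^ n. slope F n k) = 5 ^ n * (F 1 - F 0)"
  proof -
    define f where "f k = F (real k / 5 ^ n)" for k
    have "(\<Sum>k<5 ^ n. slope F n k) = 5 ^ n * (\<Sum>k<(5::nat) ^ n. f (Suc k) - f k)"
      by (simp add: slope_def f_def sum_distrib_left add.commute)
    also have "\<dots> = 5 ^ n * (f (5 ^ n) - f 0)" by (simp only: sum_lessThan_telescope)
    finally show ?thesis by (simp add: f_def)
  qed
  ultimately show False by simp
qed

lemma alive_less:
  assumes "r < 5 ^ n" and "k \<in> alive s \<delta> r i"
  shows "k < 5 ^ (n + i)"
  using assms(2)
proof (induction i arbitrary: k)
  case 0 then show ?case using assms(1) by simp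
next
  case (Suc i)
  then have "k div 5 < 5 ^ (n + i)" by simp
  then show ?case by (simp add: div_less_iff_less_mult mult.commute)
qed

section \<open>Null sets whose image is not null\<close>

proposition image_of_null_set_not_null:
  fixes F :: "real \<Rightarrow> real" and \<eta> c :: "nat \<Rightarrow> real"
  assumes cont: "continuous_on {0..1} F" and less: "F 0 < F 1"
    and \<eta>0: "\<eta> \<longlonglongrightarrow> 0"
    and affine: "\<And>n k. N \<le> n \<Longrightarrow> k < 5 ^ n \<Longrightarrow>
          \<exists>a. \<forall>x\<in>cell n k. \<forall>y\<in>cell n k. \<bar>F x - F y - a * (x - y)\<bar> \<le> \<eta> n / 5 ^ n"
    and gap: "\<And>n k. N \<le> n \<Longrightarrow> k < 5 ^ n \<Longrightarrow>
          c n \<le> \<bar>slope F (Suc n) (5 * k + 3) - slope F (Suc n) (5 * k + 1)\<bar>"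
    and c: "\<And>n. 0 \<le> c n" "\<not> summable (\<lambda>n. (c n)\<^sup>2)"
  shows "\<exists>E. E \<in> null_sets lebesgue \<and> F ` E \<notin> null_sets lebesgue"
proof -
  define \<kappa> where "\<kappa> = F 1 - F 0"
  \<comment> \<open>Slopes will change by at most \<open>6 * e\<close> per step, and the stopping
    argument needs this to be at most \<delta> and at most 2. Moreover
    \<open>\<delta> + 2 * e \<le> \<kappa> / 4\<close>, which makes images of stopped cells
    short.\<close>
  define \<delta> where "\<delta> = \<kappa> / 8"
  define e where "e = min (\<kappa> / 48) (1 / 3)"
  have pos: "0 < \<kappa>" "0 < e" using less by (auto simp: \<kappa>_def e_def)
  have e_le: "e \<le> \<kappa> / 48" "e \<le> 1 / 3" by (auto simp: e_def)
  obtain n1 where n1: "\<And>n. n1 \<le> n \<Longrightarrow> \<eta> n < e"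
    using order_tendstoD(2)[OF \<eta>0 pos(2)] by (auto simp: eventually_sequentially)
  define n0 where "n0 = max N n1"
  obtain r where r: "r < 5 ^ n0" "\<kappa> \<le> slope F n0 r"
    using exists_slope_ge[of n0 F] by (auto simp: \<kappa>_def)
  define s where "s i k = slope F (n0 + i) k" for i k
  define A where "A i = alive s \<delta> r i" for i
  have A_less: "k < 5 ^ (n0 + i)" if "k \<in> A i" for i k
    using alive_less[OF r(1)] that by (simp add: A_def)
  \<comment> \<open>The approximation serves twice: it controls the increments of the slopes, and it
    bounds the image of a whole cell by means of its slope.\<close>
  have affine': "\<exists>a. \<forall>x\<in>cell (n0 + i) k. \<forall>y\<in>cell (n0 + i) k. \<bar>F x - F y - a * (x - y)\<bar> \<le> e / 5 ^ (n0 + i)"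
    if k: "k < 5 ^ (n0 + i)" for i k
  proof -
    obtain a where a: "\<And>x y. x \<in> cell (n0 + i) k \<Longrightarrow> y \<in> cell (n0 + i) k \<Longrightarrow>
        \<bar>F x - F y - a * (x - y)\<bar> \<le> \<eta> (n0 + i) / 5 ^ (n0 + i)"
      using affine[OF _ k] by (force simp: n0_def)
    have "\<eta> (n0 + i) / 5 ^ (n0 + i) \<le> e / 5 ^ (n0 + i)"
      using n1[of "n0 + i"] by (intro divide_right_mono) (force simp: n0_def)+
    with a show ?thesis by (meson order_trans)
  qed
  \<comment> \<open>Both slopes are compared with the approximating slope \<open>a\<close> of the
    parent. The parent contributes \<open>e\<close>, and the child, being five times shorter,
    contributes \<open>5 * e\<close>.\<close>
  have inc: "\<bar>s (Suc i) k - s i (k div 5)\<bar> \<le> 6 * e" if k: "k div 5 \<in> A i" for i k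
  proof -
    define n where "n = n0 + i"
    define l where "l = k div 5"
    obtain a where a: "\<And>x y. x \<in> cell n l \<Longrightarrow> y \<in> cell n l \<Longrightarrow> \<bar>F x - F y - a * (x - y)\<bar> \<le> e / 5 ^ n"
      using affine'[of l i] A_less[of l i] k by (auto simp: l_def n_def)
    have "\<bar>s i l - a\<bar> \<le> 5 ^ n * (e / 5 ^ n)"
      unfolding s_def n_def[symmetric] by (intro abs_slope_diff_le a endpoints_in_cell)
    moreover have "\<bar>s (Suc i) k - a\<bar> \<le> 5 ^ Suc n * (e / 5 ^ n)"
      unfolding s_def add_Suc_right n_def[symmetric]
      using endpoints_in_cell[of k "Suc n"] cell_child_subset[of n k]
      by (intro abs_slope_diff_le a) (auto simp: l_def)
    ultimately show ?thesis by (auto simp: l_def)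
  qed
  \<comment> \<open>Two children whose slopes differ by \<open>c\<close> already force variance:
    \<open>(t 3 - t 1)\<^sup>2\<close> is at most twice the sum of the two squares, whence the
    factor \<open>sqrt 2\<close>.\<close>
  have var: "(c (n0 + i) / sqrt 2)\<^sup>2 \<le> (\<Sum>j<5. (s (Suc i) (5 * k + j) - s i k)\<^sup>2)"
    if "k \<in> A i" for i k
  proof -
    define t where "t j = s (Suc i) (5 * k + j) - s i k" for j
    have "c (n0 + i) \<le> \<bar>t 3 - t 1\<bar>"
      using gap[of "n0 + i" k] A_less[OF that] by (simp add: t_def s_def n0_def)
    then have "(c (n0 + i))\<^sup>2 \<le> (t 3 - t 1)\<^sup>2"
      using c(1) by (metis abs_le_square_iff abs_of_nonneg)
    also have "\<dots> \<le> 2 * ((t 1)\<^sup>2 + (t 3)\<^sup>2)"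
      using zero_le_power2[of "t 1 + t 3"] by (simp add: power2_eq_square algebra_simps)
    also have "(t 1)\<^sup>2 + (t 3)\<^sup>2 = (\<Sum>j\<in>{1, 3}. (t j)\<^sup>2)" by simp
    also have "\<dots> \<le> (\<Sum>j<5. (t j)\<^sup>2)" by (intro sum_mono2) auto
    finally show ?thesis by (simp add: t_def power_divide)
  qed
  have div: "\<not> summable (\<lambda>i. (c (n0 + i) / sqrt 2)\<^sup>2)"
  proof
    assume "summable (\<lambda>i. (c (n0 + i) / sqrt 2)\<^sup>2)"
    then have "summable (\<lambda>i. 2 * ((c (n0 + i))\<^sup>2 / 2))"
      by (intro summable_mult) (simp add: power_divide)
    then have "summable (\<lambda>i. (c (i + n0))\<^sup>2)" by (simp add: add.commute)
    with c(2) show False using summable_iff_shift[of "\<lambda>i. (c i)\<^sup>2" n0] by blast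
  qed
  have dens: "\<exists>i. card (A i) / 5 ^ i < \<epsilon>" if "0 < \<epsilon>" for \<epsilon> :: real
    unfolding A_def
  proof (rule alive_density_small[where \<eta> = "6 * e" and c = "\<lambda>i. c (n0 + i) / sqrt 2"])
    show "(\<Sum>j<5. s (Suc i) (5 * k + j)) = 5 * s i k" for i k
      by (simp add: s_def sum_slope_children)
    show "\<delta> < s 0 r" using r(2) pos by (simp add: s_def \<delta>_def)
  qed (use inc var div that pos in \<open>auto simp: A_def e_def \<delta>_def\<close>)

  \<comment> \<open>These are the points that are never stopped. At each step \<open>i\<close> the
    surviving cells cover them with total length at most \<open>card (A i) / 5 ^ i\<close>, which
    gets arbitrarily small.\<close>
  define E where "E = {x. \<forall>i. \<exists>k\<in>A i. x \<in> cell (n0 + i) k}"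
  have "negligible E"
    unfolding negligible_outer
  proof (intro allI impI)
    fix \<epsilon> :: real assume "0 < \<epsilon>"
    then obtain i where i: "card (A i) / 5 ^ i < \<epsilon>" using dens[of \<epsilon>] by blast
    define T where "T = (\<Union>k\<in>A i. cell (n0 + i) k)"
    have fin: "finite (A i)" by (simp add: A_def finite_alive)
    have "measure lebesgue T \<le> (\<Sum>k\<in>A i. measure lebesgue (cell (n0 + i) k))"
      unfolding T_def by (intro measure_UNION_le fin) (auto simp: cell_def)
    also have "\<dots> = (\<Sum>k\<in>A i. 1 / 5 ^ (n0 + i))"
      by (intro sum.cong) (auto simp: cell_def field_simps)
    also have "\<dots> \<le> card (A i) / 5 ^ i"
      by (simp add: power_add frac_le)
    finally have "measure lebesgue T < \<epsilon>" using i by linarith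
    moreover have "E \<subseteq> T" by (auto simp: E_def T_def)
    moreover have "T \<in> lmeasurable"
      unfolding T_def using fin by (intro fmeasurable.finite_UN) (auto simp: cell_def)
    ultimately show "\<exists>T. E \<subseteq> T \<and> T \<in> lmeasurable \<and> measure lebesgue T < \<epsilon>" by blast
  qed
  moreover have "F ` E \<notin> null_sets lebesgue"
  proof
    assume null: "F ` E \<in> null_sets lebesgue"
    \<comment> \<open>\<open>D i\<close> consists of the cells stopped at step \<open>Suc i\<close>.
      The image of such a cell will lie in the interval \<open>T i k\<close>, whose length is only
      \<open>\<kappa> / 2\<close> times that of the cell.\<close>
    define D where "D i = {k. k div 5 \<in> A i} - A (Suc i)" for i
    define T where "T i k = cball (F (real k / 5 ^ (n0 + Suc i))) (\<kappa> / 4 / 5 ^ (n0 + Suc i))" for i k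
    have finC: "finite {k. k div 5 \<in> A i}" for i
      by (intro finite_children) (simp add: A_def finite_alive)
    have sub: "A (Suc i) \<subseteq> {k. k div 5 \<in> A i}" for i by (auto simp: A_def)
    have image_D: "F x \<in> T i k" if k: "k \<in> D i" and x: "x \<in> cell (n0 + Suc i) k" for i k x
    proof -
      define n where "n = n0 + Suc i"
      have kA: "k div 5 \<in> A i" "s (Suc i) k \<le> \<delta>" using k by (auto simp: D_def A_def)
      have "k < 5 ^ n"
        using A_less[OF kA(1)] by (simp add: n_def div_less_iff_less_mult mult.commute)
      then obtain a where a: "\<And>x y. x \<in> cell n k \<Longrightarrow> y \<in> cell n k \<Longrightarrow> \<bar>F x - F y - a * (x - y)\<bar> \<le> e / 5 ^ n"
        using affine'[of k "Suc i"] unfolding n_def by blast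
      \<comment> \<open>The parent is still above \<delta> and one step changes the slope by at most
        \<delta>, so the slope of the stopped cell is small in absolute value and not merely from
        above.\<close>
      have "\<delta> < s i (k div 5)"
        using kA(1) r(2) pos by (cases i) (auto simp: A_def s_def \<delta>_def)
      then have "\<bar>s (Suc i) k\<bar> \<le> \<delta>"
        using inc[OF kA(1)] kA(2) by (auto simp: e_def \<delta>_def)
      moreover have "\<bar>s (Suc i) k - a\<bar> \<le> 5 ^ n * (e / 5 ^ n)"
        unfolding s_def n_def[symmetric] by (intro abs_slope_diff_le a endpoints_in_cell)
      ultimately have abs_a: "\<bar>a\<bar> \<le> \<delta> + e" by simp
      have "\<bar>x - real k / 5 ^ n\<bar> \<le> 1 / 5 ^ n"
        using x by (intro cell_diameter[OF _ endpoints_in_cell(1)]) (simp only: n_def)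
      then have "\<bar>a * (x - real k / 5 ^ n)\<bar> \<le> (\<delta> + e) * (1 / 5 ^ n)"
        unfolding abs_mult using abs_a by (intro mult_mono) auto
      moreover have "\<bar>F x - F (real k / 5 ^ n) - a * (x - real k / 5 ^ n)\<bar> \<le> e / 5 ^ n"
        using x by (intro a[OF _ endpoints_in_cell(1)]) (simp only: n_def)
      ultimately have "\<bar>F x - F (real k / 5 ^ n)\<bar> \<le> (\<delta> + e) * (1 / 5 ^ n) + e / 5 ^ n"
        by linarith
      also have "\<dots> = (\<delta> + 2 * e) / 5 ^ n" by (simp add: field_simps)
      also have "\<dots> \<le> \<kappa> / 4 / 5 ^ n"
        using e_le pos by (intro divide_right_mono) (auto simp: \<delta>_def)
      finally show ?thesis by (simp add: T_def n_def dist_real_def abs_minus_commute)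
    qed
    have cover: "F ` cell n0 r \<subseteq> F ` E \<union> (\<Union>i. \<Union>k\<in>D i. T i k)"
    proof
      fix y assume "y \<in> F ` cell n0 r"
      then obtain x where x: "x \<in> cell n0 r" "y = F x" by blast
      show "y \<in> F ` E \<union> (\<Union>i. \<Union>k\<in>D i. T i k)"
      proof (cases "x \<in> E")
        case False
        \<comment> \<open>A point outside \<open>E\<close> lies in a surviving cell at step 0 but
          not at some later step \<open>m\<close>. Hence at some step in between it passes from a
          survivor to a stopped child.\<close>
        define P where "P i \<longleftrightarrow> (\<exists>k\<in>A i. x \<in> cell (n0 + i) k)" for i
        have "P 0" using x by (auto simp: P_def A_def)
        moreover obtain m where "\<not> P m" using False by (auto simp: E_def P_def)
        ultimately obtain i where "P i" "\<not> P (Suc i)"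
          using inc_induct[of 0 m "\<lambda>i. \<not> P i"] by blast
        then obtain k where k: "k \<in> A i" "x \<in> cell (n0 + i) k" by (auto simp: P_def)
        obtain k' where k': "k' div 5 = k" "x \<in> cell (Suc (n0 + i)) k'"
          using cell_children_cover[OF k(2)] .
        then have "k' \<in> D i"
          using k \<open>\<not> P (Suc i)\<close> by (auto simp: D_def P_def)
        then have "F x \<in> T i k'" using k' by (intro image_D) auto
        then show ?thesis using x \<open>k' \<in> D i\<close> by blast
      qed (use x in blast)
    qed
    define l where "l = F (real r / 5 ^ n0)"
    define u where "u = F ((real r + 1) / 5 ^ n0)"
    have lu: "\<kappa> / 5 ^ n0 \<le> u - l"
      using r(2) by (simp add: slope_def l_def u_def field_simps)
    then have "l \<le> u" using pos by (smt (verit) divide_pos_pos zero_less_power)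
    \<comment> \<open>The intermediate value theorem gives an interval of length at least
      \<open>\<kappa> / 5 ^ n0\<close> in the image, twice what the stopped cells can cover.\<close>
    have "{l..u} \<subseteq> F ` cell n0 r"
    proof
      fix y assume "y \<in> {l..u}"
      then have "\<exists>x\<ge>real r / 5 ^ n0. x \<le> (real r + 1) / 5 ^ n0 \<and> F x = y"
        using continuous_on_subset[OF cont cell_subset_unit[OF r(1)]]
        by (intro IVT') (auto simp: l_def u_def cell_def divide_right_mono)
      then show "y \<in> F ` cell n0 r" by (auto simp: cell_def)
    qed
    from this cover have "{l..u} \<subseteq> F ` E \<union> (\<Union>i. \<Union>k\<in>D i. T i k)" by (rule subset_trans)
    moreover have T_meas: "(\<Union>k\<in>D i. T i k) \<in> sets lebesgue" for i
      using finC by (intro sets.finite_UN) (auto simp: D_def T_def)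
    ultimately have "emeasure lebesgue {l..u} \<le> emeasure lebesgue (F ` E \<union> (\<Union>i. \<Union>k\<in>D i. T i k))"
      using null by (intro emeasure_mono) auto
    also have "\<dots> = emeasure lebesgue (\<Union>i. \<Union>k\<in>D i. T i k)"
      using null T_meas by (subst Un_commute, intro emeasure_Un_null_set) auto
    also have "\<dots> \<le> (\<Sum>i. emeasure lebesgue (\<Union>k\<in>D i. T i k))"
      using T_meas by (intro emeasure_subadditive_countably) auto
    \<comment> \<open>The proportion stopped at step \<open>Suc i\<close> is
      \<open>lam i - lam (Suc i)\<close>. These proportions telescope to at most 1, so the covering
      intervals have total length at most \<open>\<kappa> / 2\<close> times the length of the
      starting cell.\<close>
    also have "\<dots> \<le> ennreal (\<kappa> / 2 / 5 ^ n0)"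
    proof (rule suminf_le_const)
      fix m
      define lam where "lam i = card (A i) / 5 ^ i" for i
      have card_D: "real (card (D i)) = 5 * real (card (A i)) - real (card (A (Suc i)))" for i
      proof -
        have "card {k. k div 5 \<in> A i} = 5 * card (A i)"
          using sum_children[of "A i" "\<lambda>_. 1"] by (simp add: A_def finite_alive)
        moreover have "card (A (Suc i)) \<le> card {k. k div 5 \<in> A i}"
          using sub finC by (rule card_mono[rotated])
        ultimately show ?thesis
          unfolding D_def using sub finC by (subst card_Diff_subset) (auto simp: A_def finite_alive)
      qed
      have "emeasure lebesgue (\<Union>k\<in>D i. T i k) \<le> ennreal ((lam i - lam (Suc i)) * (\<kappa> / 2 / 5 ^ n0))" for i
      proof -
        have "emeasure lebesgue (\<Union>k\<in>D i. T i k) \<le> (\<Sum>k\<in>D i. emeasure lebesgue (T i k))"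
          using finC by (intro emeasure_subadditive_finite) (auto simp: D_def T_def)
        also have "\<dots> = (\<Sum>k\<in>D i. ennreal (\<kappa> / 2 / 5 ^ (n0 + Suc i)))"
        proof (intro sum.cong refl)
          fix k
          show "emeasure lebesgue (T i k) = ennreal (\<kappa> / 2 / 5 ^ (n0 + Suc i))"
            using pos by (simp add: T_def cball_eq_atLeastAtMost)
        qed
        also have "\<dots> = ennreal (\<Sum>k\<in>D i. \<kappa> / 2 / 5 ^ (n0 + Suc i))"
          using pos by (intro sum_ennreal) auto
        also have "(\<Sum>k\<in>D i. \<kappa> / 2 / 5 ^ (n0 + Suc i)) = (lam i - lam (Suc i)) * (\<kappa> / 2 / 5 ^ n0)"
          by (simp add: card_D lam_def power_add field_simps)
        finally show ?thesis .
      qed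
      then have "(\<Sum>i<m. emeasure lebesgue (\<Union>k\<in>D i. T i k)) \<le>
          (\<Sum>i<m. ennreal ((lam i - lam (Suc i)) * (\<kappa> / 2 / 5 ^ n0)))"
        by (intro sum_mono) auto
      also have "\<dots> = ennreal (\<Sum>i<m. (lam i - lam (Suc i)) * (\<kappa> / 2 / 5 ^ n0))"
      proof (intro sum_ennreal mult_nonneg_nonneg)
        fix i
        have "0 \<le> real (card (D i)) / 5 ^ Suc i" by simp
        also have "\<dots> = lam i - lam (Suc i)"
          by (simp add: card_D lam_def field_simps)
        finally show "0 \<le> lam i - lam (Suc i)" .
      qed (use pos in auto)
      also have "(\<Sum>i<m. (lam i - lam (Suc i)) * (\<kappa> / 2 / 5 ^ n0)) = (lam 0 - lam m) * (\<kappa> / 2 / 5 ^ n0)"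
        by (simp only: sum_lessThan_telescope' flip: sum_distrib_right)
      also have "\<dots> \<le> 1 * (\<kappa> / 2 / 5 ^ n0)"
        using pos by (intro mult_right_mono) (auto simp: lam_def A_def)
      finally show "(\<Sum>i<m. emeasure lebesgue (\<Union>k\<in>D i. T i k)) \<le> ennreal (\<kappa> / 2 / 5 ^ n0)"
        by (simp add: ennreal_leI)
    qed simp
    finally have "ennreal (u - l) \<le> ennreal (\<kappa> / 2 / 5 ^ n0)" using \<open>l \<le> u\<close> by simp
    then have "u - l \<le> \<kappa> / 2 / 5 ^ n0" using pos by (subst (asm) ennreal_le_iff) auto
    with lu have "\<kappa> / 5 ^ n0 \<le> \<kappa> / 2 / 5 ^ n0" by linarith
    with pos show False by (simp add: field_simps)
  qed
  ultimately show ?thesis by (auto simp: negligible_iff_null_sets)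
qed

section \<open>Lacunary cosine series\<close>

text \<open>Crude bounds are enough: the first cosine is nonnegative, and the second is at most
  \<open>- sqrt 2 / 2\<close>.\<close>

lemma cos_fifth_gap: "7 / 10 \<le> cos (2 * pi / 5) - cos (4 * pi / 5)"
proof -
  have "0 \<le> cos (2 * pi / 5)" by (intro cos_ge_zero) (auto simp: field_simps)
  moreover have "cos (4 * pi / 5) \<le> cos (3 * pi / 4)"
    by (intro cos_monotone_0_pi_le) (auto simp: field_simps)
  moreover have "cos (3 * pi / 4) = - cos (pi / 4)"
    using cos_minus_pi[of "pi / 4"] cos_minus[of "pi / 4 - pi"] by (simp add: field_simps)
  moreover have "7 / 10 \<le> cos (pi / 4)"
    using real_le_rsqrt[of "7 / 5" 2] by (simp add: cos_45 power2_eq_square)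
  ultimately show ?thesis by linarith
qed

text \<open>The slack is limited: 39.5 leads to the constant 6.32 in \<open>G_slope_gap\<close>,
  which has to stay below the 7 that comes from \<open>cos_fifth_gap\<close>.\<close>

lemma two_pi_squared_less: "(2 * pi)\<^sup>2 < 39.5"
proof -
  have "(2 * pi)\<^sup>2 \<le> (2 * 3.1416)\<^sup>2" using pi_approx by (intro power_mono) auto
  then show ?thesis by (simp add: power2_eq_square)
qed

text \<open>Monotonicity starts at 1 because the intended coefficients vanish at index 0. The
  condition \<open>ratio\<close> makes \<open>5 ^ m * \<alpha> m\<close> grow by a factor of at
  least 7/2, so that the newest frequency dominates the derivative of the earlier ones.\<close>

locale lacunary =
  fixes \<alpha> :: "nat \<Rightarrow> real"
  assumes nonneg: "0 \<le> \<alpha> n"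
    and le_one: "\<alpha> n \<le> 1"
    and decreasing: "1 \<le> m \<Longrightarrow> m \<le> n \<Longrightarrow> \<alpha> n \<le> \<alpha> m"
    and ratio: "7 * \<alpha> n \<le> 10 * \<alpha> (Suc n)"
begin

definition wave :: "nat \<Rightarrow> real \<Rightarrow> real" where
  "wave m x = \<alpha> m / 5 ^ m * cos (2 * pi * 5 ^ m * x)"

definition P :: "nat \<Rightarrow> real \<Rightarrow> real" where
  "P n x = (\<Sum>m<n. wave m x)"

definition P' :: "nat \<Rightarrow> real \<Rightarrow> real" where
  "P' n x = (\<Sum>m<n. - (2 * pi * \<alpha> m * sin (2 * pi * 5 ^ m * x)))"

definition G :: "real \<Rightarrow> real" where
  "G x = (\<Sum>m. wave m x)"

lemma P_has_derivative: "(P n has_real_derivative P' n x) (at x)"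
  unfolding P_def P'_def
  by (rule DERIV_sum) (auto simp: wave_def [abs_def] intro!: derivative_eq_intros)

text \<open>Going down from index \<open>n\<close>, the terms decay at least like powers of 2/7, and
  2/7 + (2/7)^2 + ... = 2/5.\<close>

lemma sum_frequencies_le: "(\<Sum>m<n. 5 ^ m * \<alpha> m) \<le> 2 / 5 * 5 ^ n * \<alpha> n"
proof (induction n)
  case 0 then show ?case using nonneg[of 0] by simp
next
  case (Suc n)
  then have "(\<Sum>m<Suc n. 5 ^ m * \<alpha> m) \<le> 5 ^ n * (7 * \<alpha> n) / 5" by (simp add: field_simps)
  also have "\<dots> \<le> 5 ^ n * (10 * \<alpha> (Suc n)) / 5"
    using ratio[of n] by (intro divide_right_mono mult_left_mono) auto
  finally show ?case by (simp add: mult_ac)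
qed

text \<open>As \<open>sin\<close> is 1-Lipschitz, the term of index \<open>m\<close> contributes at
  most \<open>(2 * pi)\<^sup>2 * 5 ^ m * \<alpha> m\<close>. Summation gives 39.5 * 2/5 =
  15.8.\<close>

lemma P'_lipschitz: "\<bar>P' n x - P' n y\<bar> \<le> 15.8 * 5 ^ n * \<alpha> n * \<bar>x - y\<bar>"
proof -
  have "\<bar>P' n x - P' n y\<bar> \<le> (\<Sum>m<n. \<bar>2 * pi * \<alpha> m * (sin (2 * pi * 5 ^ m * y) - sin (2 * pi * 5 ^ m * x))\<bar>)"
    unfolding P'_def by (simp flip: sum_subtractf add: sum_abs right_diff_distrib algebra_simps)
  also have "\<dots> \<le> (\<Sum>m<n. (2 * pi)\<^sup>2 * \<bar>x - y\<bar> * (5 ^ m * \<alpha> m))"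
  proof (rule sum_mono)
    fix m
    have "\<bar>sin (2 * pi * 5 ^ m * y) - sin (2 * pi * 5 ^ m * x)\<bar> \<le> 1 * \<bar>2 * pi * 5 ^ m * y - 2 * pi * 5 ^ m * x\<bar>"
      using field_differentiable_bound[of UNIV sin cos 1 "2 * pi * 5 ^ m * y" "2 * pi * 5 ^ m * x"]
      by (auto intro!: derivative_eq_intros)
    also have "\<dots> = 2 * pi * 5 ^ m * \<bar>x - y\<bar>"
      by (simp add: abs_mult abs_minus_commute flip: right_diff_distrib)
    finally have "2 * pi * \<alpha> m * \<bar>sin (2 * pi * 5 ^ m * y) - sin (2 * pi * 5 ^ m * x)\<bar>
        \<le> 2 * pi * \<alpha> m * (2 * pi * 5 ^ m * \<bar>x - y\<bar>)"
      using nonneg by (intro mult_left_mono) auto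
    also have "\<dots> = (2 * pi)\<^sup>2 * \<bar>x - y\<bar> * (5 ^ m * \<alpha> m)"
      by (simp add: power2_eq_square)
    finally show "\<bar>2 * pi * \<alpha> m * (sin (2 * pi * 5 ^ m * y) - sin (2 * pi * 5 ^ m * x))\<bar>
        \<le> (2 * pi)\<^sup>2 * \<bar>x - y\<bar> * (5 ^ m * \<alpha> m)"
      using nonneg[of m] by (simp add: abs_mult)
  qed
  also have "\<dots> = (2 * pi)\<^sup>2 * \<bar>x - y\<bar> * (\<Sum>m<n. 5 ^ m * \<alpha> m)"
    by (simp add: sum_distrib_left)
  also have "\<dots> \<le> 39.5 * \<bar>x - y\<bar> * (2 / 5 * 5 ^ n * \<alpha> n)"
    using two_pi_squared_less sum_frequencies_le nonneg
    by (intro mult_mono sum_nonneg) auto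
  finally show ?thesis by (simp add: algebra_simps)
qed

text \<open>Linear growth in \<open>n\<close> is harmless, since the bound only enters error terms
  that carry an additional factor \<open>1 / 5 ^ n\<close>.\<close>

lemma abs_P'_le: "\<bar>P' n x\<bar> \<le> 7 * n"
proof -
  have "\<bar>P' n x\<bar> \<le> (\<Sum>m<n. \<bar>- (2 * pi * \<alpha> m * sin (2 * pi * 5 ^ m * x))\<bar>)"
    unfolding P'_def by (rule sum_abs)
  also have "\<dots> \<le> (\<Sum>m<n. 7)"
  proof (rule sum_mono)
    fix m
    have "2 * pi * \<alpha> m * \<bar>sin (2 * pi * 5 ^ m * x)\<bar> \<le> 7 * 1 * 1"
      using pi_approx nonneg le_one by (intro mult_mono) auto
    then show "\<bar>- (2 * pi * \<alpha> m * sin (2 * pi * 5 ^ m * x))\<bar> \<le> 7"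
      using nonneg[of m] by (simp add: abs_mult)
  qed
  finally show ?thesis by simp
qed

lemma abs_wave_le: "\<bar>wave m x\<bar> \<le> \<alpha> m / 5 ^ m"
  using mult_left_mono[OF abs_cos_le_one[of "2 * pi * 5 ^ m * x"], of "\<alpha> m / 5 ^ m"] nonneg[of m]
  by (simp add: wave_def abs_mult)

lemma abs_wave_le_geometric: "norm (wave m x) \<le> (1 / 5) ^ m"
proof -
  have "\<alpha> m / 5 ^ m \<le> 1 / 5 ^ m" using le_one by (intro divide_right_mono) auto
  then show ?thesis using abs_wave_le[of m x] by (simp add: power_divide)
qed

lemma summable_wave: "summable (\<lambda>m. wave m x)"
  by (rule summable_comparison_test'[OF summable_geometric abs_wave_le_geometric]) auto

lemma continuous_G: "continuous_on S G"
proof -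
  have "uniform_limit S P G sequentially"
    unfolding P_def G_def
    by (rule Weierstrass_m_test[OF abs_wave_le_geometric]) (auto intro: summable_geometric)
  moreover have "continuous_on S (P n)" for n
    using P_has_derivative DERIV_isCont by (blast intro: continuous_at_imp_continuous_on)
  ultimately show ?thesis
    by (intro uniform_limit_theorem[of _ P]) auto
qed

lemma G_minus_P: "G x - P n x = (\<Sum>m. wave (m + n) x)"
  using suminf_split_initial_segment[OF summable_wave, of x n] by (simp add: G_def P_def)

lemma abs_G_minus_P_le:
  assumes "1 \<le> n"
  shows "\<bar>G x - P n x\<bar> \<le> 5 / 4 * \<alpha> n / 5 ^ n"
proof -
  have bd: "norm (wave (m + n) x) \<le> \<alpha> n / 5 ^ n * (1 / 5) ^ m" for m
  proof -
    have "norm (wave (m + n) x) \<le> \<alpha> (m + n) / 5 ^ (m + n)" using abs_wave_le by simp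
    also have "\<dots> \<le> \<alpha> n / 5 ^ (m + n)"
      using decreasing assms by (intro divide_right_mono) auto
    finally show ?thesis by (simp add: power_add field_simps)
  qed
  have sm: "summable (\<lambda>m. \<alpha> n / 5 ^ n * (1 / 5 :: real) ^ m)"
    by (intro summable_mult summable_geometric) auto
  have "norm (\<Sum>m. wave (m + n) x) \<le> (\<Sum>m. \<alpha> n / 5 ^ n * (1 / 5) ^ m)"
    using bd sm by (rule norm_suminf_le)
  also have "\<dots> = \<alpha> n / 5 ^ n * (5 / 4)"
    by (subst suminf_mult) (auto simp: suminf_geometric intro: summable_geometric)
  finally show ?thesis by (simp add: G_minus_P mult.commute)
qed

lemma abs_G_le: "\<bar>G x\<bar> \<le> 2"
proof -
  have "norm (G x) \<le> (\<Sum>m. (1 / 5 :: real) ^ m)"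
    unfolding G_def by (rule norm_suminf_le[OF abs_wave_le_geometric]) (simp add: summable_geometric)
  then show ?thesis by (simp add: suminf_geometric)
qed

text \<open>At a grid point of level \<open>n\<close> all frequencies from \<open>5 ^ n\<close> on
  complete whole periods. Their contribution does not depend on \<open>k\<close> and thus cancels in
  slopes.\<close>

lemma G_at_grid: "G (real k / 5 ^ n) = P n (real k / 5 ^ n) + (\<Sum>m. \<alpha> (m + n) / 5 ^ (m + n))"
proof -
  have "wave (m + n) (real k / 5 ^ n) = \<alpha> (m + n) / 5 ^ (m + n)" for m
  proof -
    have "2 * pi * 5 ^ (m + n) * (real k / 5 ^ n) = 2 * pi * real (5 ^ m * k)"
      by (simp add: power_add)
    then have "cos (2 * pi * 5 ^ (m + n) * (real k / 5 ^ n)) = 1"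
      by (metis cos_int_2pin of_int_of_nat_eq)
    then show ?thesis by (simp add: wave_def)
  qed
  then show ?thesis using G_minus_P[of "real k / 5 ^ n" n] by simp
qed

lemma P_affine:
  assumes "x \<in> cell n k" "y \<in> cell n k" "a \<in> cell n k"
  shows "\<bar>P n x - P n y - P' n a * (x - y)\<bar> \<le> 15.8 * \<alpha> n / 5 ^ n"
proof -
  define \<phi> where "\<phi> z = P n z - P' n a * z" for z
  have "norm (\<phi> x - \<phi> y) \<le> 15.8 * \<alpha> n * norm (x - y)"
  proof (rule field_differentiable_bound[of "cell n k" \<phi> "\<lambda>z. P' n z - P' n a"])
    fix z assume z: "z \<in> cell n k"
    show "(\<phi> has_real_derivative P' n z - P' n a) (at z within cell n k)"
      unfolding \<phi>_def
      using DERIV_diff[OF P_has_derivative[of n z] DERIV_cmult_Id[of "P' n a" z UNIV]]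
      by (rule has_field_derivative_at_within)
    have "\<bar>P' n z - P' n a\<bar> \<le> 15.8 * 5 ^ n * \<alpha> n * (1 / 5 ^ n)"
      using nonneg[of n] cell_diameter[OF z assms(3)]
      by (intro order_trans[OF P'_lipschitz] mult_left_mono) auto
    then show "norm (P' n z - P' n a) \<le> 15.8 * \<alpha> n" by simp
  qed (use assms in \<open>auto simp: cell_def\<close>)
  also have "\<dots> \<le> 15.8 * \<alpha> n * (1 / 5 ^ n)"
    using nonneg cell_diameter assms by (intro mult_left_mono) auto
  finally show ?thesis by (simp add: \<phi>_def algebra_simps)
qed

text \<open>The partial sum contributes 15.8, by the Lipschitz bound on \<open>P'\<close>, and the
  tails at \<open>x\<close> and \<open>y\<close> contribute 5/4 each; the total 18.3 is rounded
  up.\<close>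

lemma G_affine:
  assumes "1 \<le> n" "x \<in> cell n k" "y \<in> cell n k" "a \<in> cell n k"
  shows "\<bar>G x - G y - P' n a * (x - y)\<bar> \<le> 20 * \<alpha> n / 5 ^ n"
proof -
  have "\<bar>G x - G y - P' n a * (x - y)\<bar> \<le> 15.8 * \<alpha> n / 5 ^ n + 5 / 4 * \<alpha> n / 5 ^ n + 5 / 4 * \<alpha> n / 5 ^ n"
    using P_affine[OF assms(2-4)] abs_G_minus_P_le[OF assms(1), of x] abs_G_minus_P_le[OF assms(1), of y]
    by linarith
  also have "\<dots> = 18.3 * (\<alpha> n / 5 ^ n)" by simp
  also have "\<dots> \<le> 20 * (\<alpha> n / 5 ^ n)"
    using nonneg by (intro mult_right_mono) auto
  finally show ?thesis by simp
qed

lemma G_lipschitz_on_cell: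
  assumes "1 \<le> n" "x \<in> cell n k" "y \<in> cell n k"
  shows "\<bar>G x - G y\<bar> \<le> (7 * n + 20) / 5 ^ n"
proof -
  have "\<bar>x - y\<bar> \<le> 1 / 5 ^ n"
    using assms cell_diameter by blast
  then have "\<bar>P' n x * (x - y)\<bar> \<le> 7 * n * (1 / 5 ^ n)"
    unfolding abs_mult using abs_P'_le by (intro mult_mono) auto
  moreover have "\<bar>G x - G y - P' n x * (x - y)\<bar> \<le> 20 * \<alpha> n / 5 ^ n"
    using G_affine assms by blast
  moreover have "20 * \<alpha> n / 5 ^ n \<le> 20 / 5 ^ n"
    using le_one by (intro divide_right_mono) auto
  ultimately have "\<bar>G x - G y\<bar> \<le> 7 * n * (1 / 5 ^ n) + 20 / 5 ^ n" by linarith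
  then show ?thesis by (simp add: add_divide_distrib)
qed

text \<open>
  The newest cosine alone separates the two slopes by at least \<open>7 * \<alpha> n\<close>, and the lower
  frequencies can undo at most \<open>6.32 * \<alpha> n\<close> of it.
\<close>

lemma G_slope_gap:
  "\<alpha> n / 2 \<le> slope G (Suc n) (5 * k + 3) - slope G (Suc n) (5 * k + 1)"
proof -
  define p where "p i = (real (5 * k + i)) / 5 ^ Suc n" for i
  define h where "h = 1 / (5::real) ^ Suc n"
  have p_eqs: "p 4 = p 2 + 2 * h" "p 3 = p 1 + 2 * h" "p 2 = p 1 + h"
    by (simp_all add: p_def h_def field_simps)
  define e where "e = \<alpha> n / 5 ^ n"
  define tail where "tail = (\<Sum>m. \<alpha> (m + Suc n) / 5 ^ (m + Suc n))"
  \<comment> \<open>On the grid of level \<open>Suc n\<close> the newest wave depends only on the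
    position \<open>i\<close> inside the parent, and all finer waves form the constant
    \<open>tail\<close>.\<close>
  have G_p: "G (p i) = P n (p i) + e * cos (2 * pi * i / 5) + tail" for i
  proof -
    have "2 * pi * 5 ^ n * p i = 2 * pi * i / 5 + 2 * pi * real k"
      by (simp add: p_def field_simps)
    then have "cos (2 * pi * 5 ^ n * p i) = cos (2 * pi * i / 5)"
      using cos_int_2pin[of "int k"] sin_int_2pin[of "int k"] by (simp add: cos_add)
    then show ?thesis
      unfolding p_def G_at_grid by (simp add: P_def wave_def e_def tail_def)
  qed
  \<comment> \<open>Children 1 and 3 are mirror images within one period of the newest cosine. Its
    slopes over them are opposite, so their difference doubles the effect.\<close>
  have cos6: "cos (2 * pi * 3 / 5) = cos (4 * pi / 5)"
  proof -
    have "2 * pi * 3 / 5 = 2 * pi - 4 * pi / 5" by simp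
    then show ?thesis by (metis cos_2pi_minus)
  qed
  have cos8: "cos (2 * pi * 4 / 5) = cos (2 * pi / 5)"
  proof -
    have "2 * pi * 4 / 5 = 2 * pi - 2 * pi / 5" by simp
    then show ?thesis by (metis cos_2pi_minus)
  qed
  \<comment> \<open>This mixed second difference of the lower frequencies is the increment of \<phi>
    over a step \<open>h\<close>. The derivative of \<phi> compares \<open>P'\<close> at distance
    \<open>2 * h\<close>, so 15.8 becomes 31.6, and rescaling leaves 31.6 / 5 = 6.32.\<close>
  define D where "D = (P n (p 4) - P n (p 3)) - (P n (p 2) - P n (p 1))"
  have D: "\<bar>D\<bar> \<le> 31.6 * \<alpha> n * 5 ^ n * h\<^sup>2"
  proof -
    define \<phi> where "\<phi> x = P n (x + 2 * h) - P n x" for x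
    have "norm (\<phi> (p 2) - \<phi> (p 1)) \<le> 31.6 * 5 ^ n * \<alpha> n * h * norm (p 2 - p 1)"
    proof (rule field_differentiable_bound[of UNIV \<phi> "\<lambda>x. P' n (x + 2 * h) - P' n x"])
      fix z
      show "(\<phi> has_real_derivative P' n (z + 2 * h) - P' n z) (at z within UNIV)"
        unfolding \<phi>_def by (intro DERIV_diff P_has_derivative) (simp add: P_has_derivative flip: DERIV_shift)
      show "norm (P' n (z + 2 * h) - P' n z) \<le> 31.6 * 5 ^ n * \<alpha> n * h"
        using P'_lipschitz[of n "z + 2 * h" z] by (simp add: h_def)
    qed auto
    moreover have "\<phi> (p 2) - \<phi> (p 1) = D"
      by (simp add: \<phi>_def D_def p_eqs(1,2))
    moreover have "norm (p 2 - p 1) = h" using p_eqs(3) by (simp add: h_def)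
    ultimately show ?thesis by (simp add: power2_eq_square algebra_simps)
  qed
  have "\<bar>5 ^ Suc n * D\<bar> \<le> 5 ^ Suc n * (31.6 * \<alpha> n * 5 ^ n * h\<^sup>2)"
    unfolding abs_mult using D by (intro mult_mono) auto
  also have "\<dots> = 6.32 * \<alpha> n"
    by (simp add: h_def power2_eq_square field_simps)
  finally have low: "- 6.32 * \<alpha> n \<le> 5 ^ Suc n * D" by linarith
  have high: "7 * \<alpha> n \<le> 5 * \<alpha> n * (2 * (cos (2 * pi / 5) - cos (4 * pi / 5)))"
    using mult_left_mono[of "7 / 5" "2 * (cos (2 * pi / 5) - cos (4 * pi / 5))" "5 * \<alpha> n"]
      cos_fifth_gap nonneg[of n] by simp
  have "real (5 * k + 1) + 1 = real (5 * k + 2)" "real (5 * k + 3) + 1 = real (5 * k + 4)"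
    by simp_all
  then have slopes: "slope G (Suc n) (5 * k + 1) = 5 ^ Suc n * (G (p 2) - G (p 1))"
    "slope G (Suc n) (5 * k + 3) = 5 ^ Suc n * (G (p 4) - G (p 3))"
    by (simp_all only: slope_def p_def)
  have c: "cos (2 * pi * real 1 / 5) = cos (2 * pi / 5)" "cos (2 * pi * real 2 / 5) = cos (4 * pi / 5)"
    "cos (2 * pi * real 3 / 5) = cos (4 * pi / 5)" "cos (2 * pi * real 4 / 5) = cos (2 * pi / 5)"
    using cos6 cos8 by simp_all
  have "\<alpha> n / 2 \<le> - 6.32 * \<alpha> n + 7 * \<alpha> n" using nonneg[of n] by simp
  also have "\<dots> \<le> 5 ^ Suc n * D + 5 * \<alpha> n * (2 * (cos (2 * pi / 5) - cos (4 * pi / 5)))"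
    using low high by (rule add_mono)
  also have "5 * \<alpha> n = 5 ^ Suc n * e" by (simp add: e_def)
  also have "5 ^ Suc n * D + 5 ^ Suc n * e * (2 * (cos (2 * pi / 5) - cos (4 * pi / 5))) =
      5 ^ Suc n * ((G (p 4) - G (p 3)) - (G (p 2) - G (p 1)))"
    unfolding G_p c D_def by algebra
  also have "\<dots> = slope G (Suc n) (5 * k + 3) - slope G (Suc n) (5 * k + 1)"
    by (simp only: slopes right_diff_distrib)
  finally show ?thesis .
qed

end

section \<open>Smooth multipliers\<close>

text \<open>A single constant \<open>B\<close> bounds the weight, its derivative and the Lipschitz
  constant of the derivative; the lower bound \<open>w\<close> preserves the slope gap of
  \<open>G\<close>.\<close>

locale weighted_lacunary = lacunary +
  fixes W W' :: "real \<Rightarrow> real" and w B :: real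
  assumes W_deriv: "x \<in> {0..1} \<Longrightarrow> (W has_real_derivative W' x) (at x within {0..1})"
    and W'_bound: "x \<in> {0..1} \<Longrightarrow> \<bar>W' x\<bar> \<le> B"
    and W'_lipschitz: "x \<in> {0..1} \<Longrightarrow> y \<in> {0..1} \<Longrightarrow> \<bar>W' x - W' y\<bar> \<le> B * \<bar>x - y\<bar>"
    and W_bounds: "x \<in> {0..1} \<Longrightarrow> w \<le> W x" "x \<in> {0..1} \<Longrightarrow> W x \<le> B"
    and w_pos: "0 < w"
begin

lemma B_pos: "0 < B"
  using W_bounds[of 0] w_pos by simp

lemma W_affine:
  assumes "k < 5 ^ n" "x \<in> cell n k" "y \<in> cell n k" "a \<in> cell n k"
  shows "\<bar>W x - W y\<bar> \<le> B / 5 ^ n" "\<bar>W x - W y - W' a * (x - y)\<bar> \<le> B / 5 ^ n / 5 ^ n"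
proof -
  have sub: "cell n k \<subseteq> {0..1}" using assms(1) by (rule cell_subset_unit)
  have deriv: "(W has_real_derivative W' z) (at z within cell n k)" if "z \<in> cell n k" for z
    using W_deriv[of z] sub that by (blast intro: DERIV_subset)
  have convex: "convex (cell n k)" by (simp add: cell_def)
  have diam: "\<bar>x - y\<bar> \<le> 1 / 5 ^ n" using assms by (intro cell_diameter)
  have "norm (W x - W y) \<le> B * norm (x - y)"
    using sub W'_bound assms by (intro field_differentiable_bound[OF convex deriv]) auto
  also have "\<dots> \<le> B * (1 / 5 ^ n)" using diam B_pos by (intro mult_left_mono) auto
  finally show "\<bar>W x - W y\<bar> \<le> B / 5 ^ n" by simp
  define \<phi> where "\<phi> z = W z - W' a * z" for z
  have "norm (\<phi> x - \<phi> y) \<le> B / 5 ^ n * norm (x - y)"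
  proof (rule field_differentiable_bound[OF convex, of \<phi> "\<lambda>z. W' z - W' a"])
    fix z assume z: "z \<in> cell n k"
    show "(\<phi> has_real_derivative W' z - W' a) (at z within cell n k)"
      unfolding \<phi>_def by (intro DERIV_diff deriv z DERIV_cmult_Id)
    have "\<bar>W' z - W' a\<bar> \<le> B * (1 / 5 ^ n)"
      using z assms(4) sub B_pos cell_diameter[OF z assms(4)]
      by (intro order_trans[OF W'_lipschitz] mult_left_mono) auto
    then show "norm (W' z - W' a) \<le> B / 5 ^ n" by simp
  qed (use assms in auto)
  also have "\<dots> \<le> B / 5 ^ n * (1 / 5 ^ n)" using diam B_pos by (intro mult_left_mono) auto
  finally show "\<bar>W x - W y - W' a * (x - y)\<bar> \<le> B / 5 ^ n / 5 ^ n"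
    by (simp add: \<phi>_def algebra_simps)
qed

text \<open>After freezing \<open>W\<close>, \<open>W'\<close> and the factor \<open>G\<close> of
  \<open>W'\<close> at \<open>a\<close>, only second-order errors remain: two products of increments
  and the Taylor remainder of \<open>W\<close> times \<open>G a\<close>. With
  \<open>\<bar>G a\<bar> \<le> 2\<close> the constant is 2 * (7 n + 20) + 2 = 14 n + 42.\<close>

lemma product_increment:
  assumes n: "1 \<le> n" and k: "k < 5 ^ n" and xya: "x \<in> cell n k" "y \<in> cell n k" "a \<in> cell n k"
  shows "\<bar>W x * G x - W y * G y - (W a * (G x - G y) + W' a * G a * (x - y))\<bar>
      \<le> B * (14 * real n + 42) / 5 ^ n / 5 ^ n"
proof -
  define h where "h = 1 / (5::real) ^ n"
  define K where "K = 7 * real n + 20"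
  have G: "\<bar>G u - G v\<bar> \<le> K * h" if "u \<in> cell n k" "v \<in> cell n k" for u v
    using G_lipschitz_on_cell[OF n that] by (simp add: K_def h_def)
  have Wd: "\<bar>W u - W v\<bar> \<le> B * h" if "u \<in> cell n k" "v \<in> cell n k" for u v
    using W_affine(1)[OF k that that(1)] by (simp add: h_def)
  have "0 \<le> B * h" "0 \<le> K * h" using B_pos by (auto simp: h_def K_def)
  then have "\<bar>(W x - W a) * (G x - G y)\<bar> \<le> (B * h) * (K * h)"
    unfolding abs_mult using xya by (intro mult_mono G Wd) auto
  moreover have "\<bar>(G y - G a) * (W x - W y)\<bar> \<le> (K * h) * (B * h)"
    unfolding abs_mult using xya \<open>0 \<le> K * h\<close> by (intro mult_mono G Wd) auto
  moreover have "\<bar>G a * (W x - W y - W' a * (x - y))\<bar> \<le> 2 * (B * h * h)"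
    unfolding abs_mult using W_affine(2)[OF k xya] by (intro mult_mono abs_G_le) (auto simp: h_def)
  moreover have "W x * G x - W y * G y - (W a * (G x - G y) + W' a * G a * (x - y)) =
      (W x - W a) * (G x - G y) + (G y - G a) * (W x - W y) + G a * (W x - W y - W' a * (x - y))"
    by algebra
  ultimately have "\<bar>W x * G x - W y * G y - (W a * (G x - G y) + W' a * G a * (x - y))\<bar>
      \<le> (B * h) * (K * h) + (K * h) * (B * h) + 2 * (B * h * h)"
    by linarith
  also have "\<dots> = B * (14 * real n + 42) * h * h" by (simp add: K_def algebra_simps)
  finally show ?thesis by (simp add: h_def)
qed

lemma product_affine:
  assumes n: "1 \<le> n" and k: "k < 5 ^ n"
  shows "\<exists>s. \<forall>x\<in>cell n k. \<forall>y\<in>cell n k. \<bar>W x * G x - W y * G y - s * (x - y)\<bar>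
      \<le> (B * 20 * \<alpha> n + B * (14 * real n + 42) / 5 ^ n) / 5 ^ n"
proof (intro exI ballI)
  fix x y assume xy: "x \<in> cell n k" "y \<in> cell n k"
  define a where "a = real k / 5 ^ n"
  have a: "a \<in> cell n k" unfolding a_def by (rule endpoints_in_cell)
  have "0 \<le> W a" "W a \<le> B" using W_bounds[of a] cell_subset_unit[OF k] a w_pos by auto
  then have "\<bar>W a * (G x - G y - P' n a * (x - y))\<bar> \<le> B * (20 * \<alpha> n / 5 ^ n)"
    unfolding abs_mult using G_affine[OF n xy a] by (intro mult_mono) auto
  \<comment> \<open>The approximating slope is given by the product rule at the left endpoint, with
    \<open>P' n a\<close> in place of a derivative of \<open>G\<close>.\<close>
  moreover have "W x * G x - W y * G y - (W a * P' n a + W' a * G a) * (x - y) =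
      (W x * G x - W y * G y - (W a * (G x - G y) + W' a * G a * (x - y)))
      + W a * (G x - G y - P' n a * (x - y))"
    by algebra
  ultimately have "\<bar>W x * G x - W y * G y - (W a * P' n a + W' a * G a) * (x - y)\<bar>
      \<le> B * (14 * real n + 42) / 5 ^ n / 5 ^ n + B * (20 * \<alpha> n / 5 ^ n)"
    using product_increment[OF n k xy a] by linarith
  also have "\<dots> = (B * 20 * \<alpha> n + B * (14 * real n + 42) / 5 ^ n) / 5 ^ n"
    by (simp add: add_divide_distrib)
  finally show "\<bar>W x * G x - W y * G y - (W a * P' n a + W' a * G a) * (x - y)\<bar>
      \<le> (B * 20 * \<alpha> n + B * (14 * real n + 42) / 5 ^ n) / 5 ^ n" .
qed

text \<open>The term \<open>W' a * G a\<close> is common to both children and cancels. Half of the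
  weighted gap \<open>w * (\<alpha> n / 2)\<close> absorbs the two errors \<open>5 * e\<close>, and
  the other half remains.\<close>

lemma product_slope_gap:
  assumes n: "1 \<le> n" and k: "k < 5 ^ n"
    and small: "10 * B * (14 * real n + 42) / 5 ^ n \<le> w / 4 * \<alpha> n"
  shows "w / 4 * \<alpha> n \<le> \<bar>slope (\<lambda>x. W x * G x) (Suc n) (5 * k + 3) - slope (\<lambda>x. W x * G x) (Suc n) (5 * k + 1)\<bar>"
proof -
  define a where "a = real k / 5 ^ n"
  define F where "F x = W x * G x" for x
  define e where "e = B * (14 * real n + 42) / 5 ^ n"
  have a: "a \<in> cell n k" unfolding a_def by (rule endpoints_in_cell)
  have Wa: "w \<le> W a" using W_bounds[of a] cell_subset_unit[OF k] a by auto
  have *: "\<bar>slope F (Suc n) l - (W a * slope G (Suc n) l + W' a * G a)\<bar> \<le> 5 * e"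
    if l: "l div 5 = k" for l
  proof -
    define u where "u = real l / 5 ^ Suc n"
    define v where "v = (real l + 1) / 5 ^ Suc n"
    have uv: "v \<in> cell n k" "u \<in> cell n k"
      using cell_child_subset[of n l] endpoints_in_cell[of l "Suc n"] l by (auto simp: u_def v_def)
    have "v - u = 1 / 5 ^ Suc n" by (simp add: u_def v_def add_divide_distrib)
    then have vu: "5 ^ Suc n * (v - u) = 1" by simp
    have "q * (F v - F u) - (W a * (q * (G v - G u)) + W' a * G a * (q * (v - u))) =
        q * (F v - F u - (W a * (G v - G u) + W' a * G a * (v - u)))" for q
      by algebra
    from this[of "5 ^ Suc n"]
    have "slope F (Suc n) l - (W a * slope G (Suc n) l + W' a * G a) =
        5 ^ Suc n * (F v - F u - (W a * (G v - G u) + W' a * G a * (v - u)))"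
      by (simp only: vu slope_def mult_1_right flip: u_def v_def)
    also have "\<bar>\<dots>\<bar> \<le> 5 ^ Suc n * (e / 5 ^ n)"
      unfolding abs_mult using product_increment[OF n k uv a]
      by (intro mult_mono) (auto simp: F_def e_def)
    finally show ?thesis by simp
  qed
  have divs: "(5 * k + 3) div 5 = k" "(5 * k + 1) div 5 = k" by simp_all
  have "w * (\<alpha> n / 2) \<le> W a * (slope G (Suc n) (5 * k + 3) - slope G (Suc n) (5 * k + 1))"
    using Wa w_pos nonneg[of n] G_slope_gap[of n k] by (intro mult_mono) auto
  then have "w * (\<alpha> n / 2) - 10 * e \<le> slope F (Suc n) (5 * k + 3) - slope F (Suc n) (5 * k + 1)"
    using * [OF divs(1)] * [OF divs(2)] unfolding right_diff_distrib by linarith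
  moreover have "10 * e \<le> w / 4 * \<alpha> n" using small by (simp add: e_def)
  ultimately show ?thesis unfolding F_def by linarith
qed

text \<open>By periodicity \<open>G\<close> takes the same value at 0 and 1, and this value is
  positive, so the growth of \<open>W\<close> alone gives the product a positive total
  increment.\<close>

proposition product_image_of_null_set_not_null:
  assumes "W 0 < W 1" and \<alpha>0: "\<alpha> \<longlonglongrightarrow> 0" and div: "\<not> summable (\<lambda>n. (\<alpha> n)\<^sup>2)"
    and small: "\<forall>\<^sub>F n in sequentially. 10 * B * (14 * real n + 42) / 5 ^ n \<le> w / 4 * \<alpha> n"
  shows "\<exists>E. E \<in> null_sets lebesgue \<and> (\<lambda>x. W x * G x) ` E \<notin> null_sets lebesgue"
proof -
  obtain N where N: "\<And>n. N \<le> n \<Longrightarrow> 10 * B * (14 * real n + 42) / 5 ^ n \<le> w / 4 * \<alpha> n"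
    using small by (auto simp: eventually_sequentially)
  show ?thesis
  proof (rule image_of_null_set_not_null[where N = "max N 1" and c = "\<lambda>n. w / 4 * \<alpha> n"
        and \<eta> = "\<lambda>n. B * 20 * \<alpha> n + B * (14 * real n + 42) / 5 ^ n"])
    show "continuous_on {0..1} (\<lambda>x. W x * G x)"
      by (intro continuous_on_mult continuous_G) (rule DERIV_continuous_on[OF W_deriv])
    have "(\<lambda>n. B * (14 * real n + 42) / 5 ^ n) \<longlonglongrightarrow> 0" by real_asymp
    then show "(\<lambda>n. B * 20 * \<alpha> n + B * (14 * real n + 42) / 5 ^ n) \<longlonglongrightarrow> 0"
      using tendsto_add[OF tendsto_mult_right_zero[OF \<alpha>0, of "B * 20"]] by auto
    show "\<not> summable (\<lambda>n. (w / 4 * \<alpha> n)\<^sup>2)"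
      using div w_pos by (simp only: power_mult_distrib summable_cmult_iff) auto
    obtain i where "\<alpha> i \<noteq> 0"
    proof (rule ccontr)
      assume "\<not> thesis"
      then have "\<alpha> n = 0" for n using that by blast
      then have "(\<lambda>n. (\<alpha> n)\<^sup>2) = (\<lambda>n. 0)" by simp
      with div show False by simp
    qed
    then have "0 < \<alpha> i" using nonneg[of i] by simp
    define S where "S = (\<Sum>m. \<alpha> m / 5 ^ m)"
    have GS: "G 0 = S" "G 1 = S"
      using G_at_grid[of 0 0] G_at_grid[of 1 0] by (simp_all add: S_def P_def)
    have "summable (\<lambda>m. \<alpha> m / 5 ^ m)" using summable_wave[of 0] by (simp add: wave_def)
    then have "0 < S" unfolding S_def
      using \<open>0 < \<alpha> i\<close> nonneg by (intro suminf_pos2[where i = i]) auto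
    then show "W 0 * G 0 < W 1 * G 1" using assms(1) by (simp add: GS)
  qed (use N product_affine product_slope_gap nonneg w_pos in auto)
qed

end

section \<open>Power coefficients and the Gaussian weight\<close>

lemma powr_succ_ratio_le:
  fixes x :: real
  assumes "1 \<le> x" "0 \<le> \<sigma>" "\<sigma> \<le> 1 / 2"
  shows "7 * x powr - \<sigma> \<le> 10 * (x + 1) powr - \<sigma>"
proof -
  \<comment> \<open>Since \<open>x + 1 \<le> 2 * x\<close>, the ratio of the powers is at most
    \<open>2 powr \<sigma> \<le> sqrt 2\<close>, which is below 10/7.\<close>
  have "7 * (x + 1) powr \<sigma> \<le> 7 * (2 * x) powr \<sigma>"
    using assms by (intro mult_left_mono powr_mono2) auto
  also have "(2 * x) powr \<sigma> = 2 powr \<sigma> * x powr \<sigma>" using assms by (simp add: powr_mult)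
  also have "7 * (2 powr \<sigma> * x powr \<sigma>) \<le> 7 * (2 powr (1 / 2) * x powr \<sigma>)"
    using assms by (intro mult_left_mono mult_right_mono powr_mono) auto
  also have "\<dots> \<le> 7 * (10 / 7 * x powr \<sigma>)"
    using real_le_lsqrt[of "10 / 7" 2]
    by (intro mult_left_mono mult_right_mono) (auto simp: powr_half_sqrt power2_eq_square)
  finally have "7 * (x + 1) powr \<sigma> \<le> 10 * x powr \<sigma>" by simp
  then show ?thesis using assms by (simp add: powr_minus field_simps)
qed

text \<open>The centre 1 places \<open>{0..1}\<close> on the increasing side of the Gaussian: the
  substitution sends it to \<open>{-2 * pi..0}\<close>.\<close>

definition weight :: "real \<Rightarrow> real" where
  "weight x = exp (- (2 * pi * (x - 1))\<^sup>2)"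

definition weight' :: "real \<Rightarrow> real" where
  "weight' x = - (8 * pi\<^sup>2 * (x - 1)) * weight x"

lemma weight_deriv: "(weight has_real_derivative weight' x) (at x)"
  unfolding weight_def [abs_def] weight'_def
  by (auto intro!: derivative_eq_intros simp: power2_eq_square)

lemma weight_range: "0 < weight x" "weight x \<le> 1"
  by (simp_all add: weight_def)

lemma abs_weight'_le:
  assumes "x \<in> {0..1}"
  shows "\<bar>weight' x\<bar> \<le> 8 * pi\<^sup>2"
proof -
  have "\<bar>weight' x\<bar> = 8 * pi\<^sup>2 * (\<bar>x - 1\<bar> * weight x)"
    using weight_range[of x] by (simp add: weight'_def abs_mult)
  also have "\<dots> \<le> 8 * pi\<^sup>2 * (1 * 1)"
    using assms weight_range[of x] by (intro mult_left_mono mult_mono) auto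
  finally show ?thesis by simp
qed

lemma weight'_lipschitz:
  assumes "x \<in> {0..1}" "y \<in> {0..1}"
  shows "\<bar>weight' x - weight' y\<bar> \<le> (8 * pi\<^sup>2 + (8 * pi\<^sup>2)\<^sup>2) * \<bar>x - y\<bar>"
proof -
  have "norm (weight' x - weight' y) \<le> (8 * pi\<^sup>2 + (8 * pi\<^sup>2)\<^sup>2) * norm (x - y)"
  proof (rule field_differentiable_bound[of "{0..1}" weight'
        "\<lambda>z. - (8 * pi\<^sup>2) * weight z + - (8 * pi\<^sup>2 * (z - 1)) * weight' z"])
    fix z :: real assume z: "z \<in> {0..1}"
    have "(weight' has_real_derivative - (8 * pi\<^sup>2) * weight z + - (8 * pi\<^sup>2 * (z - 1)) * weight' z) (at z)"
      unfolding weight'_def [abs_def]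
      by (rule DERIV_cong[OF DERIV_mult[OF _ weight_deriv]])
        (auto intro!: derivative_eq_intros simp: weight'_def)
    then show "(weight' has_real_derivative - (8 * pi\<^sup>2) * weight z + - (8 * pi\<^sup>2 * (z - 1)) * weight' z)
        (at z within {0..1})"
      by (rule has_field_derivative_at_within)
    have "\<bar>(8 * pi\<^sup>2) * weight z\<bar> \<le> 8 * pi\<^sup>2" using weight_range[of z] by (simp add: abs_mult)
    moreover have "\<bar>(8 * pi\<^sup>2 * (z - 1)) * weight' z\<bar> \<le> (8 * pi\<^sup>2 * 1) * (8 * pi\<^sup>2)"
      unfolding abs_mult using z by (intro mult_mono abs_weight'_le) auto
    moreover have "\<bar>- (8 * pi\<^sup>2) * weight z + - (8 * pi\<^sup>2 * (z - 1)) * weight' z\<bar>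
        \<le> \<bar>(8 * pi\<^sup>2) * weight z\<bar> + \<bar>(8 * pi\<^sup>2 * (z - 1)) * weight' z\<bar>"
      by (rule order_trans[OF abs_triangle_ineq]) (simp only: mult_minus_left abs_minus_cancel)
    ultimately have "\<bar>- (8 * pi\<^sup>2) * weight z + - (8 * pi\<^sup>2 * (z - 1)) * weight' z\<bar>
        \<le> 8 * pi\<^sup>2 + (8 * pi\<^sup>2 * 1) * (8 * pi\<^sup>2)"
      by linarith
    then show "norm (- (8 * pi\<^sup>2) * weight z + - (8 * pi\<^sup>2 * (z - 1)) * weight' z)
        \<le> 8 * pi\<^sup>2 + (8 * pi\<^sup>2)\<^sup>2"
      by (simp only: real_norm_def mult_1_right flip: power2_eq_square)
  qed (use assms in auto)
  then show ?thesis by simp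
qed

theorem theorem1p7:
  fixes \<sigma> :: real
  assumes "1/3 < \<sigma>" and "\<sigma> < 1/2"
  shows "\<exists>E :: real set. E \<in> null_sets lebesgue \<and> f_sigma \<sigma> ` E \<notin> null_sets lebesgue"
proof -
  \<comment> \<open>At index 0 the value is \<open>0 powr - \<sigma> = 0\<close>, so a series over
    all \<open>m\<close> agrees with the one that starts at 1.\<close>
  define \<alpha> where "\<alpha> m = real m powr - \<sigma>" for m
  \<comment> \<open>The weight is smallest at 0. The three summands of \<open>B\<close> together
    dominate the bounds 1 for the weight, \<open>8 * pi\<^sup>2\<close> for its derivative and
    \<open>8 * pi\<^sup>2 + (8 * pi\<^sup>2)\<^sup>2\<close> for the Lipschitz constant of the
    derivative.\<close>
  interpret weighted_lacunary \<alpha> weight weight' "weight 0" "1 + 8 * pi\<^sup>2 + (8 * pi\<^sup>2)\<^sup>2"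
  proof
    show "0 \<le> \<alpha> n" for n by (simp add: \<alpha>_def)
    show decr: "\<alpha> n \<le> \<alpha> m" if "1 \<le> m" "m \<le> n" for m n
      using that assms by (simp add: \<alpha>_def powr_minus powr_mono2 le_imp_inverse_le)
    show "\<alpha> n \<le> 1" for n
      using decr[of 1 n] by (cases "n = 0") (auto simp: \<alpha>_def)
    show "7 * \<alpha> n \<le> 10 * \<alpha> (Suc n)" for n
      using powr_succ_ratio_le[of "real n" \<sigma>] assms by (cases "n = 0") (auto simp: \<alpha>_def add.commute)
    fix x :: real assume x: "x \<in> {0..1}"
    show "(weight has_real_derivative weight' x) (at x within {0..1})"
      using weight_deriv by (rule has_field_derivative_at_within)
    show "\<bar>weight' x\<bar> \<le> 1 + 8 * pi\<^sup>2 + (8 * pi\<^sup>2)\<^sup>2"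
      using abs_weight'_le[OF x] zero_le_power2[of "8 * pi\<^sup>2"] by linarith
    show "weight x \<le> 1 + 8 * pi\<^sup>2 + (8 * pi\<^sup>2)\<^sup>2"
      using weight_range[of x] zero_le_power2[of "8 * pi\<^sup>2"] zero_le_power2[of pi] by linarith
    show "weight 0 \<le> weight x"
      using x by (simp add: weight_def power_mult_distrib power2_commute[of x] abs_square_le_1)
    fix y :: real assume y: "y \<in> {0..1}"
    show "\<bar>weight' x - weight' y\<bar> \<le> (1 + 8 * pi\<^sup>2 + (8 * pi\<^sup>2)\<^sup>2) * \<bar>x - y\<bar>"
      by (rule order_trans[OF weight'_lipschitz[OF x y]]) (intro mult_right_mono; simp)
  qed (simp add: weight_range)
  have "\<exists>E. E \<in> null_sets lebesgue \<and> (\<lambda>x. weight x * G x) ` E \<notin> null_sets lebesgue"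
  proof (rule product_image_of_null_set_not_null)
    show "weight 0 < weight 1" by (simp add: weight_def)
    show "\<alpha> \<longlonglongrightarrow> 0" unfolding \<alpha>_def using assms by real_asymp
    \<comment> \<open>The exponent \<open>- 2 * \<sigma>\<close> is larger than -1, so the series of
      squares diverges.\<close>
    have "(\<lambda>n. (\<alpha> n)\<^sup>2) = (\<lambda>n. real n powr (- 2 * \<sigma>))"
      by (auto simp: \<alpha>_def power2_eq_square simp flip: powr_add)
    then show "\<not> summable (\<lambda>n. (\<alpha> n)\<^sup>2)"
      using assms by (simp add: summable_real_powr_iff)
    show "\<forall>\<^sub>F n in sequentially. 10 * (1 + 8 * pi\<^sup>2 + (8 * pi\<^sup>2)\<^sup>2) * (14 * real n + 42) / 5 ^ n \<le> weight 0 / 4 * \<alpha> n"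
      unfolding \<alpha>_def using assms weight_range[of 0] by real_asymp
  qed
  then obtain E where E: "E \<in> null_sets lebesgue" "(\<lambda>x. weight x * G x) ` E \<notin> null_sets lebesgue"
    by blast
  define T where "T x = 2 * pi * (x - 1)" for x :: real
  have f_T: "f_sigma \<sigma> (T x) = weight x * G x" for x
  proof -
    have wave0: "wave 0 x = 0" by (simp add: wave_def \<alpha>_def)
    have "5 powr (- real (Suc m)) * real (Suc m) powr (- \<sigma>) * cos (5 ^ Suc m * T x) = wave (Suc m) x" for m
    proof -
      \<comment> \<open>The shift in \<open>T\<close> moves the argument of each cosine by a whole
        multiple of \<open>2 * pi\<close>, so it is visible only in the Gaussian factor.\<close>
      have "5 ^ Suc m * T x = 2 * pi * 5 ^ Suc m * x - 2 * pi * real (5 ^ Suc m)"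
        by (simp add: T_def algebra_simps)
      moreover have "cos (2 * pi * real j) = 1" "sin (2 * pi * real j) = 0" for j
        using cos_int_2pin[of "int j"] sin_int_2pin[of "int j"] by simp_all
      ultimately have "cos (5 ^ Suc m * T x) = cos (2 * pi * 5 ^ Suc m * x)"
        by (simp only: cos_diff mult_1_right mult_zero_right add_0_right)
      moreover have "5 powr (- real (Suc m)) = 1 / 5 ^ Suc m"
      proof -
        have "(5::real) powr (- real (Suc m)) = inverse (5 powr real (Suc m))" by (rule powr_minus)
        also have "(5::real) powr real (Suc m) = 5 ^ Suc m" by (rule powr_realpow) simp
        finally show ?thesis by (simp only: inverse_eq_divide)
      qed
      ultimately show ?thesis
        by (simp only: wave_def \<alpha>_def times_divide_eq_left mult_1_left)
    qed
    moreover have "(\<Sum>m. wave (Suc m) x) = G x"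
      using suminf_split_head[OF summable_wave[of x]] wave0 by (simp add: G_def)
    ultimately show ?thesis by (simp only: f_sigma_def) (simp add: weight_def T_def)
  qed
  \<comment> \<open>The affine map \<open>T\<close> is differentiable and so carries the null set
    back to the original variable.\<close>
  have "negligible (T ` E)"
  proof (rule negligible_differentiable_image_negligible)
    show "negligible E" using E(1) by (simp add: negligible_iff_null_sets)
    show "T differentiable_on E"
      unfolding T_def by (intro derivative_intros)
  qed simp
  moreover have "f_sigma \<sigma> ` T ` E = (\<lambda>x. weight x * G x) ` E"
    by (simp add: image_image f_T)
  ultimately show ?thesis using E(2) by (auto simp: negligible_iff_null_sets)
qed

end
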